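(* Work in the "linear" axiomatic framework for three-dimensional projective space described in the context. Let $o,p,q,r$ be a plane-tetrad, and let its diagonals be the lines $$a \in \mathrm{pt}(o,p)\cap\mathrm{pt}(q,r),\quad b \in \mathrm{pt}(o,q)\cap\mathrm{pt}(r,p),\quad c \in \mathrm{pt}(o,r)\cap\mathrm{pt}(p,q)$$ (each of these intersections consists of exactly one line). Then $a, b, c$ are pairwise distinct and each of $a,b,c$ is distinct from each of $o,p,q,r$.
   Context: Let $\mathbb{L}$ be a set (whose elements are called lines) with a symmetric reflexive relation $\sim$ (incidence). Lines that are not incident are called skew. For $S \subseteq \mathbb{L}$ let $S^{\sim}$ be the set of all lines incident to every line of $S$, and write $[l_1 \dots l_n] = \{l_1,\dots,l_n\}^{\sim}$. The axioms are: Axiom [1]: for each line $l$, the set $\{l\}^{\sim}$ contains three pairwise skew lines. Axiom [2]: for each incident pair of distinct lines $a,b$: (2.1) $[ab]$ contains skew pairs of lines; (2.2) if $c \in [ab]\setminus[ab]^{\sim}$ is one of such a skew pair, then no skew pairs lie in $[abc]$; (2.3) if $x,y$ is a skew pair in $[ab]$ then $[ab] = [abx]\cup[aby]$. Axiom [3]: if $a,b$ is an incident line pair and $c \in [ab]\setminus[ab]^{\sim}$, then there exist an incident line pair $p,q$ and $r \in [pq]\setminus[pq]^{\sim}$ with $[abc]\cap[pqr]=\emptyset$. For incident distinct lines $a,b$ put $\Sigma(a,b) = [ab]\setminus[ab]^{\sim}$; incidence restricted to $\Sigma(a,b)$ is an equivalence relation with exactly two classes, which (as part of the structure) are labelled $\Sigma_{\mathrm{pt}}(a,b)$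 and $\Sigma_{\mathrm{pl}}(a,b)$. The point $\mathrm{pt}(a,b) = [abc]$ with $c \in \Sigma_{\mathrm{pt}}(a,b)$ and the plane $\mathrm{pl}(a,b) = [abc]$ with $c \in \Sigma_{\mathrm{pl}}(a,b)$ are independent of the choice of $c$. Axiom [4]: whenever $a,b$ and $p,q$ are pairs of distinct incident lines, $\mathrm{pt}(a,b)\cap\mathrm{pt}(p,q)\neq\emptyset$ and $\mathrm{pl}(a,b)\cap\mathrm{pl}(p,q)\neq\emptyset$. A triad is a triple of pairwise-incident lines $a,b,c$ with $c \in \Sigma(a,b)$ (equivalently $a\in\Sigma(b,c)$, equivalently $b \in \Sigma(c,a)$). It is a plane-triad if $a\in\Sigma_{\mathrm{pl}}(b,c)$, $b\in\Sigma_{\mathrm{pl}}(c,a)$, $c\in\Sigma_{\mathrm{pl}}(a,b)$, and a point-triad if the same holds with $\mathrm{pt}$ in place of $\mathrm{pl}$. A plane-tetrad is a set $\{o,p,q,r\}$ of four pairwise-incident lines such that each of the triples $\{p,q,r\},\{o,q,r\},\{o,r,p\},\{o,p,q\}$ is a plane-triad. *)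

theory Defs
  imports Main
begin

definition perp :: "('l \<Rightarrow> 'l \<Rightarrow> bool) \<Rightarrow> 'l set \<Rightarrow> 'l set" where
  "perp inc S = {x. \<forall>s\<in>S. inc x s}"

definition Sig :: "('l \<Rightarrow> 'l \<Rightarrow> bool) \<Rightarrow> 'l \<Rightarrow> 'l \<Rightarrow> 'l set" where
  "Sig inc a b = perp inc {a, b} - perp inc (perp inc {a, b})"

text \<open>In the axioms, an incident pair always consists of two distinct lines. In \<open>axiom2_2\<close>, the line
  \<open>c \<in> Sig inc a b\<close> is automatically a member of a skew pair in \<open>perp inc {a, b}\<close>, by the definition
  of \<open>Sig\<close>.\<close>

locale line_incidence =
  fixes inc :: "'l \<Rightarrow> 'l \<Rightarrow> bool" (infix "\<sim>" 50)
  assumes inc_refl: "a \<sim> a"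
    and inc_sym: "a \<sim> b \<Longrightarrow> b \<sim> a"
    and axiom1: "\<exists>x y z. {x, y, z} \<subseteq> perp (\<sim>) {l} \<and> \<not> x \<sim> y \<and> \<not> y \<sim> z \<and> \<not> z \<sim> x"
    and axiom2_1: "\<lbrakk>a \<noteq> b; a \<sim> b\<rbrakk> \<Longrightarrow> \<exists>x\<in>perp (\<sim>) {a, b}. \<exists>y\<in>perp (\<sim>) {a, b}. \<not> x \<sim> y"
    and axiom2_2: "\<lbrakk>a \<noteq> b; a \<sim> b; c \<in> Sig (\<sim>) a b\<rbrakk>
      \<Longrightarrow> \<not> (\<exists>x\<in>perp (\<sim>) {a, b, c}. \<exists>y\<in>perp (\<sim>) {a, b, c}. \<not> x \<sim> y)"
    and axiom2_3: "\<lbrakk>a \<noteq> b; a \<sim> b; x \<in> perp (\<sim>) {a, b}; y \<in> perp (\<sim>) {a, b}; \<not> x \<sim> y\<rbrakk>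
      \<Longrightarrow> perp (\<sim>) {a, b} = perp (\<sim>) {a, b, x} \<union> perp (\<sim>) {a, b, y}"
    and axiom3: "\<lbrakk>a \<noteq> b; a \<sim> b; c \<in> Sig (\<sim>) a b\<rbrakk>
      \<Longrightarrow> \<exists>p q r. p \<noteq> q \<and> p \<sim> q \<and> r \<in> Sig (\<sim>) p q \<and>
            perp (\<sim>) {a, b, c} \<inter> perp (\<sim>) {p, q, r} = {}"

definition Sig_rel :: "('l \<Rightarrow> 'l \<Rightarrow> bool) \<Rightarrow> 'l \<Rightarrow> 'l \<Rightarrow> 'l rel" where
  "Sig_rel inc a b = {(x, y). x \<in> Sig inc a b \<and> y \<in> Sig inc a b \<and> inc x y}"

context line_incidence
begin

lemma equiv_Sig_rel:
  assumes ab: "a \<noteq> b" "a \<sim> b"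
  shows "equiv (Sig (\<sim>) a b) (Sig_rel (\<sim>) a b)"
proof (rule equivI)
  show "Sig_rel (\<sim>) a b \<subseteq> Sig (\<sim>) a b \<times> Sig (\<sim>) a b"
    by (auto simp: Sig_rel_def)
  show "refl_on (Sig (\<sim>) a b) (Sig_rel (\<sim>) a b)"
    by (auto simp: refl_on_def Sig_rel_def inc_refl)
  show "sym (Sig_rel (\<sim>) a b)"
    by (auto simp: sym_def Sig_rel_def inc_sym)
  show "trans (Sig_rel (\<sim>) a b)"
  proof (rule transI)
    fix x y z
    assume "(x, y) \<in> Sig_rel (\<sim>) a b" "(y, z) \<in> Sig_rel (\<sim>) a b"
    then have *: "x \<in> Sig (\<sim>) a b" "y \<in> Sig (\<sim>) a b" "z \<in> Sig (\<sim>) a b" "x \<sim> y" "y \<sim> z"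
      by (auto simp: Sig_rel_def)
    then have "x \<in> perp (\<sim>) {a, b, y}" "z \<in> perp (\<sim>) {a, b, y}"
      by (auto simp: Sig_def perp_def intro: inc_sym)
    with axiom2_2[OF ab *(2)] have "x \<sim> z" by blast
    with * show "(x, z) \<in> Sig_rel (\<sim>) a b" by (simp add: Sig_rel_def)
  qed
qed

lemma card_Sig_classes:
  assumes ab: "a \<noteq> b" "a \<sim> b"
  shows "card (Sig (\<sim>) a b // Sig_rel (\<sim>) a b) = 2"
proof -
  let ?R = "Sig_rel (\<sim>) a b"
  obtain x y where xy: "x \<in> perp (\<sim>) {a, b}" "y \<in> perp (\<sim>) {a, b}" "\<not> x \<sim> y"
    using axiom2_1[OF ab] by blast
  then have S: "x \<in> Sig (\<sim>) a b" "y \<in> Sig (\<sim>) a b"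
    using inc_sym by (auto simp: Sig_def perp_def)
  have "z \<sim> x \<or> z \<sim> y" if "z \<in> Sig (\<sim>) a b" for z
    using axiom2_3[OF ab xy] that by (auto simp: Sig_def perp_def)
  then have "?R `` {z} = ?R `` {x} \<or> ?R `` {z} = ?R `` {y}" if "z \<in> Sig (\<sim>) a b" for z
    using that S equiv_class_eq[OF equiv_Sig_rel[OF ab]] by (auto simp: Sig_rel_def)
  then have "Sig (\<sim>) a b // ?R = {?R `` {x}, ?R `` {y}}"
    using S by (auto simp: quotient_def)
  moreover have "?R `` {x} \<noteq> ?R `` {y}"
    using S xy inc_refl by (auto simp: Sig_rel_def)
  ultimately show ?thesis by simp
qed

lemma perp_Sig_class_cong:
  assumes "(c, d) \<in> Sig_rel (\<sim>) a b" and ab: "a \<noteq> b" "a \<sim> b"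
  shows "perp (\<sim>) {a, b, c} = perp (\<sim>) {a, b, d}"
proof -
  have "perp (\<sim>) {a, b, c} \<subseteq> perp (\<sim>) {a, b, d}" if cd: "(c, d) \<in> Sig_rel (\<sim>) a b" for c d
  proof
    fix x assume x: "x \<in> perp (\<sim>) {a, b, c}"
    from cd have "c \<in> Sig (\<sim>) a b" "d \<in> perp (\<sim>) {a, b, c}"
      by (auto simp: Sig_rel_def Sig_def perp_def intro: inc_sym)
    with axiom2_2[OF ab] x have "x \<sim> d" by blast
    with x show "x \<in> perp (\<sim>) {a, b, d}" by (auto simp: perp_def)
  qed
  moreover have "(d, c) \<in> Sig_rel (\<sim>) a b"
    using assms(1) by (auto simp: Sig_rel_def intro: inc_sym)
  ultimately show ?thesis using assms(1) by blast
qed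

end

text \<open>The labelling is given by functions \<open>Spt\<close> and \<open>Spl\<close>, where \<open>Spt a b\<close> and \<open>Spl a b\<close> are the
  two classes of \<open>Sig inc a b\<close>; their values are constrained, and used, only for incident distinct
  \<open>a\<close>, \<open>b\<close>.\<close>

definition pt :: "('l \<Rightarrow> 'l \<Rightarrow> bool) \<Rightarrow> ('l \<Rightarrow> 'l \<Rightarrow> 'l set) \<Rightarrow> 'l \<Rightarrow> 'l \<Rightarrow> 'l set" where
  "pt inc Spt a b = (THE P. \<exists>c\<in>Spt a b. P = perp inc {a, b, c})"

definition pl :: "('l \<Rightarrow> 'l \<Rightarrow> bool) \<Rightarrow> ('l \<Rightarrow> 'l \<Rightarrow> 'l set) \<Rightarrow> 'l \<Rightarrow> 'l \<Rightarrow> 'l set" where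
  "pl inc Spl a b = (THE P. \<exists>c\<in>Spl a b. P = perp inc {a, b, c})"

locale line_geometry = line_incidence inc
  for inc :: "'l \<Rightarrow> 'l \<Rightarrow> bool" (infix "\<sim>" 50) +
  fixes Spt Spl :: "'l \<Rightarrow> 'l \<Rightarrow> 'l set"
  assumes labelling: "\<lbrakk>a \<noteq> b; a \<sim> b\<rbrakk>
      \<Longrightarrow> Sig (\<sim>) a b // Sig_rel (\<sim>) a b = {Spt a b, Spl a b} \<and> Spt a b \<noteq> Spl a b"
    and axiom4: "\<lbrakk>a \<noteq> b; a \<sim> b; p \<noteq> q; p \<sim> q\<rbrakk>
      \<Longrightarrow> pt (\<sim>) Spt a b \<inter> pt (\<sim>) Spt p q \<noteq> {} \<and> pl (\<sim>) Spl a b \<inter> pl (\<sim>) Spl p q \<noteq> {}"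
begin

lemma pt_eq:
  assumes ab: "a \<noteq> b" "a \<sim> b" and c: "c \<in> Spt a b"
  shows "pt (\<sim>) Spt a b = perp (\<sim>) {a, b, c}"
proof -
  have "Spt a b \<in> Sig (\<sim>) a b // Sig_rel (\<sim>) a b" using labelling[OF ab] by simp
  then have "(c, d) \<in> Sig_rel (\<sim>) a b" if "d \<in> Spt a b" for d
    using quotient_eq_iff[OF equiv_Sig_rel[OF ab]] c that by blast
  then show ?thesis
    unfolding pt_def using c perp_Sig_class_cong[OF _ ab] by (intro the_equality) blast+
qed

lemma pl_eq:
  assumes ab: "a \<noteq> b" "a \<sim> b" and c: "c \<in> Spl a b"
  shows "pl (\<sim>) Spl a b = perp (\<sim>) {a, b, c}"
proof -
  have "Spl a b \<in> Sig (\<sim>) a b // Sig_rel (\<sim>) a b" using labelling[OF ab] by simp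
  then have "(c, d) \<in> Sig_rel (\<sim>) a b" if "d \<in> Spl a b" for d
    using quotient_eq_iff[OF equiv_Sig_rel[OF ab]] c that by blast
  then show ?thesis
    unfolding pl_def using c perp_Sig_class_cong[OF _ ab] by (intro the_equality) blast+
qed

lemma Sig_cases:
  assumes ab: "a \<noteq> b" "a \<sim> b" and c: "c \<in> Sig (\<sim>) a b"
  shows "c \<in> Spt a b \<or> c \<in> Spl a b"
  using Union_quotient[OF equiv_Sig_rel[OF ab]] labelling[OF ab] c by auto

text \<open>The labelling does not depend on the order of \<open>a\<close> and \<open>b\<close>; this need not be assumed, as it
  follows from \<open>axiom3\<close> and \<open>axiom4\<close>.\<close>

lemma labelling_commute:
  assumes ab: "a \<noteq> b" "a \<sim> b"
  shows "Spt a b = Spt b a" "Spl a b = Spl b a"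
proof -
  have ba: "b \<noteq> a" "b \<sim> a" using ab inc_sym by auto
  have S: "Sig (\<sim>) b a = Sig (\<sim>) a b" by (simp add: Sig_def insert_commute)
  then have R: "Sig_rel (\<sim>) b a = Sig_rel (\<sim>) a b" by (simp add: Sig_rel_def)
  have two: "{Spt a b, Spl a b} = {Spt b a, Spl b a}" "Spt a b \<noteq> Spl a b"
    using labelling[OF ab] labelling[OF ba] S R by auto
  have "Spt a b \<noteq> Spl b a"
  proof
    assume eq: "Spt a b = Spl b a"
    have "Spt a b \<in> Sig (\<sim>) a b // Sig_rel (\<sim>) a b" using labelling[OF ab] by simp
    then obtain c where c: "c \<in> Spt a b" "c \<in> Sig (\<sim>) a b"
      using in_quotient_imp_non_empty[OF equiv_Sig_rel[OF ab]]
        in_quotient_imp_subset[OF equiv_Sig_rel[OF ab]] by blast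
    then obtain p q r where pq: "p \<noteq> q" "p \<sim> q" and r: "r \<in> Sig (\<sim>) p q"
      and disj: "perp (\<sim>) {a, b, c} \<inter> perp (\<sim>) {p, q, r} = {}"
      using axiom3[OF ab] by blast
    have pt: "pt (\<sim>) Spt a b = perp (\<sim>) {a, b, c}" using pt_eq[OF ab c(1)] .
    have pl: "pl (\<sim>) Spl b a = perp (\<sim>) {a, b, c}"
      using pl_eq[OF ba, of c] c(1) eq by (simp add: insert_commute)
    from Sig_cases[OF pq r] show False
      using axiom4[OF ab pq] axiom4[OF ba pq] pt pl pt_eq[OF pq, of r] pl_eq[OF pq, of r] disj
      by auto
  qed
  with two show "Spt a b = Spt b a" "Spl a b = Spl b a" by (auto simp: doubleton_eq_iff)
qed

end

definition triad :: "('l \<Rightarrow> 'l \<Rightarrow> bool) \<Rightarrow> 'l \<Rightarrow> 'l \<Rightarrow> 'l \<Rightarrow> bool" where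
  "triad inc a b c \<longleftrightarrow>
     distinct [a, b, c] \<and> inc a b \<and> inc b c \<and> inc c a \<and> c \<in> Sig inc a b"

definition plane_triad ::
    "('l \<Rightarrow> 'l \<Rightarrow> bool) \<Rightarrow> ('l \<Rightarrow> 'l \<Rightarrow> 'l set) \<Rightarrow> 'l \<Rightarrow> 'l \<Rightarrow> 'l \<Rightarrow> bool" where
  "plane_triad inc Spl a b c \<longleftrightarrow>
     triad inc a b c \<and> a \<in> Spl b c \<and> b \<in> Spl c a \<and> c \<in> Spl a b"

definition plane_tetrad ::
    "('l \<Rightarrow> 'l \<Rightarrow> bool) \<Rightarrow> ('l \<Rightarrow> 'l \<Rightarrow> 'l set) \<Rightarrow> 'l \<Rightarrow> 'l \<Rightarrow> 'l \<Rightarrow> 'l \<Rightarrow> bool" where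
  "plane_tetrad inc Spl o' p q r \<longleftrightarrow>
     distinct [o', p, q, r] \<and> (\<forall>x\<in>{o', p, q, r}. \<forall>y\<in>{o', p, q, r}. inc x y) \<and>
     plane_triad inc Spl p q r \<and> plane_triad inc Spl o' q r \<and>
     plane_triad inc Spl o' r p \<and> plane_triad inc Spl o' p q"

end

theory Submission
  imports Defs
begin

text \<open>Two distinct points have at most one common line: if \<open>x \<noteq> y\<close> both lay in \<open>pt p s\<close> and
  \<open>pt q t\<close>, then the lines witnessing that \<open>q\<close> misses the first point and that \<open>p\<close> misses the second
  would all belong to \<open>[xy]\<close>, against the transitivity of incidence on \<open>\<Sigma>(x,y)\<close>. This gives both
  the uniqueness of the diagonals and, applied to two vertices of the tetrad on the common side \<open>o\<close>,
  their distinctness: a line equal to two diagonals would be a side.\<close>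

context line_geometry
begin

text \<open>Unfolds the \<open>THE\<close> in \<open>pt\<close> once and for all. Distinct classes
  of an equivalence have no related members, so every line of \<open>Spl a b\<close> is skew to the
  witness \<open>c\<close>.\<close>

lemma pt_witness:
  assumes ab: "a \<noteq> b" "a \<sim> b"
  obtains c where "pt (\<sim>) Spt a b = perp (\<sim>) {a, b, c}" "c \<in> Sig (\<sim>) a b"
    "\<And>x. x \<in> Spl a b \<Longrightarrow> \<not> x \<sim> c"
proof -
  note E = equiv_Sig_rel[OF ab]
  have Q: "Spt a b \<in> Sig (\<sim>) a b // Sig_rel (\<sim>) a b" "Spl a b \<in> Sig (\<sim>) a b // Sig_rel (\<sim>) a b"
    and ne: "Spt a b \<noteq> Spl a b"
    using labelling[OF ab] by auto
  obtain c where c: "c \<in> Spt a b"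
    using in_quotient_imp_non_empty[OF E Q(1)] by blast
  have sub: "Spt a b \<subseteq> Sig (\<sim>) a b" "Spl a b \<subseteq> Sig (\<sim>) a b"
    using in_quotient_imp_subset[OF E] Q by blast+
  have "\<not> x \<sim> c" if x: "x \<in> Spl a b" for x
  proof
    assume "x \<sim> c"
    then have "(x, c) \<in> Sig_rel (\<sim>) a b" using x c sub by (auto simp: Sig_rel_def)
    then show False using quotient_eq_iff[OF E Q(2) Q(1) x c] ne by blast
  qed
  with pt_eq[OF ab c] c sub show thesis by (blast intro: that)
qed

lemma left_in_pt:
  assumes "a \<noteq> b" "a \<sim> b"
  shows "a \<in> pt (\<sim>) Spt a b"
  by (rule pt_witness[OF assms]) (use assms inc_refl inc_sym in \<open>auto simp: perp_def Sig_def\<close>)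

lemma pt_commute:
  assumes ab: "a \<noteq> b" "a \<sim> b"
  shows "pt (\<sim>) Spt a b = pt (\<sim>) Spt b a"
  by (simp add: pt_def labelling_commute(1)[OF ab] insert_commute)

lemma pt_disjoint_Spl:
  assumes "a \<noteq> b" "a \<sim> b"
  shows "pt (\<sim>) Spt a b \<inter> Spl a b = {}"
  by (rule pt_witness[OF assms]) (auto simp: perp_def)

lemma pt_incident:
  assumes ab: "a \<noteq> b" "a \<sim> b" and "x \<in> pt (\<sim>) Spt a b" "y \<in> pt (\<sim>) Spt a b"
  shows "x \<sim> y"
  using pt_witness[OF ab] axiom2_2[OF ab] assms(3,4) by metis

text \<open>The skew partner \<open>w\<close> places \<open>y\<close> in
  \<open>Sig (\<sim>) a b\<close>; then \<open>axiom2_2\<close> forbids skew pairs among the lines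
  of \<open>perp (\<sim>) {a, b}\<close> that meet \<open>y\<close>.\<close>

lemma incident_trans_perp:
  assumes ab: "a \<noteq> b" "a \<sim> b" and mem: "{x, y, z, w} \<subseteq> perp (\<sim>) {a, b}"
    and "\<not> y \<sim> w" "x \<sim> y" "z \<sim> y"
  shows "x \<sim> z"
proof -
  have "y \<in> Sig (\<sim>) a b" using mem assms(4) by (auto simp: Sig_def perp_def)
  moreover have "x \<in> perp (\<sim>) {a, b, y}" "z \<in> perp (\<sim>) {a, b, y}"
    using mem assms(5,6) by (auto simp: perp_def)
  ultimately show ?thesis using axiom2_2[OF ab] by blast
qed

text \<open>The two \<open>Spl\<close> hypotheses express that neither point contains the line that
  spans the other: \<open>q\<close> is skew to a line \<open>c\<close> of the first class,
  \<open>p\<close> to a line \<open>d\<close> of the second.\<close>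

lemma pt_inter_unique:
  assumes ps: "p \<noteq> s" "p \<sim> s" and qt: "q \<noteq> t" "q \<sim> t" and "p \<sim> q"
    and "q \<in> Spl p s" "p \<in> Spl q t"
    and x: "x \<in> pt (\<sim>) Spt p s \<inter> pt (\<sim>) Spt q t"
    and y: "y \<in> pt (\<sim>) Spt p s \<inter> pt (\<sim>) Spt q t"
  shows "x = y"
proof (rule ccontr)
  assume "x \<noteq> y"
  have "x \<sim> y" using pt_incident[OF ps] x y by blast
  obtain c where c: "pt (\<sim>) Spt p s = perp (\<sim>) {p, s, c}" "c \<in> Sig (\<sim>) p s" "\<not> q \<sim> c"
    using pt_witness[OF ps] assms(6) by metis
  obtain d where d: "pt (\<sim>) Spt q t = perp (\<sim>) {q, t, d}" "\<not> p \<sim> d"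
    using pt_witness[OF qt] assms(7) by metis
  \<comment> \<open>\<open>p\<close> and \<open>c\<close> help define the first point,
    \<open>q\<close> and \<open>d\<close> the second, so both \<open>x\<close> and \<open>y\<close>
    meet all four. With \<open>d\<close> as skew partner of \<open>p\<close>, incidence passes
    through \<open>p\<close> from \<open>q\<close> to \<open>c\<close>.\<close>
  have "{q, p, c, d} \<subseteq> perp (\<sim>) {x, y}"
    using x y c(1) d(1) inc_sym by (auto simp: perp_def)
  moreover have "q \<sim> p" "c \<sim> p" using \<open>p \<sim> q\<close> c(2) inc_sym by (auto simp: perp_def Sig_def)
  ultimately have "q \<sim> c"
    using incident_trans_perp[OF \<open>x \<noteq> y\<close> \<open>x \<sim> y\<close>] d(2) by blast
  with c(3) show False by blast
qed

lemma ex1_pt_inter: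
  assumes "p \<noteq> s" "p \<sim> s" "q \<noteq> t" "q \<sim> t" "p \<sim> q" "q \<in> Spl p s" "p \<in> Spl q t"
  shows "\<exists>!x. x \<in> pt (\<sim>) Spt p s \<inter> pt (\<sim>) Spt q t"
  using axiom4[OF assms(1-4)] pt_inter_unique[OF assms] by blast

text \<open>The line \<open>o'\<close> itself lies in both points, so uniqueness identifies
  \<open>x\<close> with it.\<close>

lemma pt_inter_common_line:
  assumes op: "o' \<noteq> p" "o' \<sim> p" and oq: "o' \<noteq> q" "o' \<sim> q" and "p \<sim> q"
    and "q \<in> Spl o' p" "p \<in> Spl o' q"
    and x: "x \<in> pt (\<sim>) Spt o' p" "x \<in> pt (\<sim>) Spt o' q"
  shows "x = o'"
proof (rule pt_inter_unique[of p o' q o'])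
  show "q \<in> Spl p o'" "p \<in> Spl q o'"
    using assms(6,7) labelling_commute(2)[OF op] labelling_commute(2)[OF oq] by auto
  show "x \<in> pt (\<sim>) Spt p o' \<inter> pt (\<sim>) Spt q o'" "o' \<in> pt (\<sim>) Spt p o' \<inter> pt (\<sim>) Spt q o'"
    using x left_in_pt[OF op] left_in_pt[OF oq] pt_commute[OF op] pt_commute[OF oq] by auto
qed (use assms inc_sym in auto)

end

theorem theorem2:
  fixes inc :: "'l \<Rightarrow> 'l \<Rightarrow> bool"
    and Spt Spl :: "'l \<Rightarrow> 'l \<Rightarrow> 'l set"
    and o' p q r :: 'l
  assumes "line_geometry inc Spt Spl"
    and "plane_tetrad inc Spl o' p q r"
  shows "(\<exists>!a. a \<in> pt inc Spt o' p \<inter> pt inc Spt q r) \<and>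
         (\<exists>!b. b \<in> pt inc Spt o' q \<inter> pt inc Spt r p) \<and>
         (\<exists>!c. c \<in> pt inc Spt o' r \<inter> pt inc Spt p q) \<and>
         (\<forall>a b c. a \<in> pt inc Spt o' p \<inter> pt inc Spt q r \<longrightarrow>
                  b \<in> pt inc Spt o' q \<inter> pt inc Spt r p \<longrightarrow>
                  c \<in> pt inc Spt o' r \<inter> pt inc Spt p q \<longrightarrow>
                  distinct [a, b, c] \<and> {a, b, c} \<inter> {o', p, q, r} = {})"
proof -
  interpret line_geometry inc Spt Spl by fact
  have ne: "o' \<noteq> p" "o' \<noteq> q" "o' \<noteq> r" "q \<noteq> r" "r \<noteq> p" "p \<noteq> q"
    and inc: "inc o' p" "inc o' q" "inc o' r" "inc q r" "inc r p" "inc p q" "inc p r"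
    using assms(2) by (auto simp: plane_tetrad_def)
  \<comment> \<open>Each pair's plane class contains both remaining lines of the tetrad;
    commutativity of the labelling supplies the orders that the cyclic definition omits.\<close>
  have Spl: "q \<in> Spl o' p" "r \<in> Spl o' p" "r \<in> Spl o' q" "p \<in> Spl o' q" "p \<in> Spl o' r" "q \<in> Spl o' r"
    "o' \<in> Spl q r" "p \<in> Spl q r" "o' \<in> Spl r p" "q \<in> Spl r p" "o' \<in> Spl p q" "r \<in> Spl p q"
    using assms(2) labelling_commute(2)[OF ne(1) inc(1)] labelling_commute(2)[OF ne(2) inc(2)]
      labelling_commute(2)[OF ne(3) inc(3)]
    by (auto simp: plane_tetrad_def plane_triad_def)
  have off: "{a, b, c} \<inter> {o', p, q, r} = {}" and dist: "distinct [a, b, c]"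
    if a: "a \<in> pt inc Spt o' p \<inter> pt inc Spt q r"
      and b: "b \<in> pt inc Spt o' q \<inter> pt inc Spt r p"
      and c: "c \<in> pt inc Spt o' r \<inter> pt inc Spt p q" for a b c
  proof -
    \<comment> \<open>For each diagonal, a line of the tetrad belongs to one of its two defining
      pairs and so to the plane class of the other, which that pair's point avoids.\<close>
    show off: "{a, b, c} \<inter> {o', p, q, r} = {}"
      using a b c Spl
        pt_disjoint_Spl[OF ne(1) inc(1)] pt_disjoint_Spl[OF ne(2) inc(2)]
        pt_disjoint_Spl[OF ne(3) inc(3)] pt_disjoint_Spl[OF ne(4) inc(4)]
        pt_disjoint_Spl[OF ne(5) inc(5)] pt_disjoint_Spl[OF ne(6) inc(6)]
      by blast
    \<comment> \<open>A common value would lie in two points on \<open>o'\<close>, hence equal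
      \<open>o'\<close>, which \<open>off\<close> excludes.\<close>
    have "a \<noteq> b"
      using pt_inter_common_line[OF ne(1) inc(1) ne(2) inc(2) inc(6) Spl(1,4)] a b off by blast
    moreover have "b \<noteq> c"
      using pt_inter_common_line[OF ne(2) inc(2) ne(3) inc(3) inc(4) Spl(3,6)] b c off by blast
    moreover have "a \<noteq> c"
      using pt_inter_common_line[OF ne(1) inc(1) ne(3) inc(3) inc(7) Spl(2,5)] a c off by blast
    ultimately show "distinct [a, b, c]" by simp
  qed
  show ?thesis
    using ex1_pt_inter[OF ne(1) inc(1) ne(4) inc(4) inc(2) Spl(1,7)]
      ex1_pt_inter[OF ne(2) inc(2) ne(5) inc(5) inc(3) Spl(3,9)]
      ex1_pt_inter[OF ne(3) inc(3) ne(6) inc(6) inc(1) Spl(5,11)] off dist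
    by (intro conjI allI impI) assumption+
qed

end
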